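(* Let $d\geq 1$ and let $\mathcal{T}\in \operatorname{End}(\mathbb{R}^d)$ be a linear operator. Then for any set $K\subset \mathbb{R}^d$ we have $$\mu_\star (K+\mathcal{T} K)\ge H(\mathcal{T}) \cdot \mu_\star (K).$$
   Context: $\mu$ is the Lebesgue measure in $\mathbb{R}^d$ and $\mu_\star$ is the corresponding inner Lebesgue measure, i.e. $\mu_\star(X)=\sup\{\mu(C): C\subset X,\ C \text{ compact}\}$. $K+\mathcal{T}K=\{x+\mathcal{T}y : x,y\in K\}$. For a linear operator $\mathcal{T}\in\operatorname{End}(\mathbb{R}^d)$ (over $\mathbb{R}$), $H(\mathcal{T})=\prod_{i=1}^d(1+|\lambda_i|)$, where $\lambda_1,\ldots,\lambda_d$ are the complex eigenvalues of $\mathcal{T}$ listed with algebraic multiplicities. *)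

theory Defs
  imports "HOL-Analysis.Analysis" "HOL-Computational_Algebra.Polynomial"
begin

text \<open>The supremum is taken in the extended nonnegative reals, so it is
  \<open>\<infinity>\<close> when \<open>X\<close> contains compact sets of arbitrarily large measure.\<close>

definition inner_lebesgue :: "(real ^ 'n) set \<Rightarrow> ennreal" where
  "inner_lebesgue X = (SUP C \<in> {C. compact C \<and> C \<subseteq> X}. emeasure lebesgue C)"

definition complex_matrix :: "(real ^ 'n \<Rightarrow> real ^ 'n) \<Rightarrow> complex ^ 'n ^ 'n" where
  "complex_matrix T = map_matrix complex_of_real (matrix T)"

definition complex_eigenvalue :: "(real ^ 'n \<Rightarrow> real ^ 'n) \<Rightarrow> complex \<Rightarrow> bool" where
  "complex_eigenvalue T l \<longleftrightarrow> (\<exists>v. v \<noteq> 0 \<and> complex_matrix T *v v = l *s v)"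

definition charpoly :: "(real ^ 'n \<Rightarrow> real ^ 'n) \<Rightarrow> complex poly" where
  "charpoly T = det (\<chi> i j. (if i = j then [:0, 1:] else 0) - [:complex_matrix T $ i $ j:])"

definition alg_mult :: "(real ^ 'n \<Rightarrow> real ^ 'n) \<Rightarrow> complex \<Rightarrow> nat" where
  "alg_mult T l = order l (charpoly T)"

text \<open>Each eigenvalue contributes one factor per unit of algebraic multiplicity. The
  index set is finite, see \<open>finite_complex_eigenvalues\<close> below.\<close>

definition H :: "(real ^ 'n \<Rightarrow> real ^ 'n) \<Rightarrow> real" where
  "H T = (\<Prod>l | complex_eigenvalue T l. (1 + cmod l) ^ alg_mult T l)"

lemma poly_det:
  fixes M :: "complex poly ^ 'n ^ 'n"
  shows "poly (det M) x = det (\<chi> i j. poly (M $ i $ j) x)"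
  by (simp add: det_def poly_sum poly_prod)

lemma poly_charpoly:
  "poly (charpoly T) x = det (mat x - complex_matrix T)"
  unfolding charpoly_def poly_det
  by (rule arg_cong[where f = det]) (simp add: vec_eq_iff mat_def)

lemma mat_vector_mul: "mat x *v v = x *s (v :: complex ^ 'n)"
  by (simp add: vec_eq_iff matrix_vector_mult_def mat_def if_distrib[where f = "\<lambda>t. t * _"]
      cong: if_cong)

lemma complex_eigenvalue_iff_root:
  "complex_eigenvalue T l \<longleftrightarrow> poly (charpoly T) l = 0"
proof -
  let ?B = "mat l - complex_matrix T"
  have "poly (charpoly T) l = 0 \<longleftrightarrow> \<not> invertible ?B"
    by (simp add: poly_charpoly invertible_det_nz)
  also have "\<dots> \<longleftrightarrow> (\<exists>v. v \<noteq> 0 \<and> ?B *v v = 0)"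
    unfolding invertible_left_inverse matrix_left_invertible_ker by blast
  also have "\<dots> \<longleftrightarrow> complex_eigenvalue T l"
    unfolding complex_eigenvalue_def
    by (auto simp: matrix_vector_mult_diff_rdistrib mat_vector_mul)
  finally show ?thesis by simp
qed

lemma complex_eigenvalue_bound:
  assumes "complex_eigenvalue T l"
  shows "cmod l \<le> (\<Sum>i\<in>UNIV. \<Sum>j\<in>UNIV. cmod (complex_matrix T $ i $ j))"
proof -
  let ?A = "complex_matrix T"
  obtain v where v: "v \<noteq> 0" "?A *v v = l *s v"
    using assms by (auto simp: complex_eigenvalue_def)
  obtain k where k: "\<And>j. cmod (v $ j) \<le> cmod (v $ k)"
  proof -
    have "Max (range (\<lambda>j. cmod (v $ j))) \<in> range (\<lambda>j. cmod (v $ j))"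
      by (rule Max_in) auto
    then obtain k where "Max (range (\<lambda>j. cmod (v $ j))) = cmod (v $ k)" by (rule rangeE)
    then have "cmod (v $ j) \<le> cmod (v $ k)" for j
      by (metis Max_ge finite finite_imageI rangeI)
    then show ?thesis by (rule that)
  qed
  have pos: "cmod (v $ k) > 0"
  proof (rule ccontr)
    assume "\<not> cmod (v $ k) > 0"
    then have "cmod (v $ j) \<le> 0" for j using k[of j] by linarith
    then show False using v(1) by (simp add: vec_eq_iff)
  qed
  have "l * v $ k = (\<Sum>j\<in>UNIV. ?A $ k $ j * v $ j)"
    using v(2) by (simp add: vec_eq_iff matrix_vector_mult_def)
  then have "cmod l * cmod (v $ k) = cmod (\<Sum>j\<in>UNIV. ?A $ k $ j * v $ j)"
    by (metis norm_mult)
  also have "\<dots> \<le> (\<Sum>j\<in>UNIV. cmod (?A $ k $ j) * cmod (v $ k))"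
    by (rule sum_norm_le) (simp add: norm_mult mult_left_mono k)
  also have "\<dots> = (\<Sum>j\<in>UNIV. cmod (?A $ k $ j)) * cmod (v $ k)"
    by (simp add: sum_distrib_right)
  finally have "cmod l \<le> (\<Sum>j\<in>UNIV. cmod (?A $ k $ j))"
    using pos by simp
  also have "\<dots> \<le> (\<Sum>i\<in>UNIV. \<Sum>j\<in>UNIV. cmod (?A $ i $ j))"
    by (rule member_le_sum) (auto intro: sum_nonneg)
  finally show ?thesis .
qed

lemma charpoly_nonzero: "charpoly T \<noteq> 0"
proof
  assume "charpoly T = 0"
  then have ev: "complex_eigenvalue T l" for l by (simp add: complex_eigenvalue_iff_root)
  let ?S = "\<Sum>i\<in>UNIV. \<Sum>j\<in>UNIV. cmod (complex_matrix T $ i $ j)"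
  have "cmod (complex_of_real (?S + 1)) \<le> ?S" by (rule complex_eigenvalue_bound[OF ev])
  then show False by (simp only: norm_of_real)
qed

lemma finite_complex_eigenvalues: "finite {l. complex_eigenvalue T l}"
  using poly_roots_finite[OF charpoly_nonzero] by (simp add: complex_eigenvalue_iff_root)

text \<open>Equivalently, \<open>H\<close> is a product over the multiset of roots of the characteristic
  polynomial.\<close>

lemma H_eq_prod_proots: "H T = (\<Prod>l\<in>#proots (charpoly T). 1 + cmod l)"
  unfolding H_def alg_mult_def complex_eigenvalue_iff_root
  using charpoly_nonzero[of T] by (simp add: image_prod_mset_multiplicity)

end

theory Submission
  imports "Jordan_Normal_Form.Schur_Decomposition" Defs
begin

text \<open>
  Passing from \<open>A\<close> to \<open>A \<times> A\<close> complexifies \<open>T\<close> and squares both sides, so one may work on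
  \<open>\<complex>\<^sup>n\<close>; a linear change of variables multiplies all volumes by the same constant, so by Schur
  the operator may be taken triangular. For a triangular operator, add the coordinates one
  at a time. If the fibres of \<open>A\<close> over \<open>w\<close> and \<open>w'\<close> have area more than \<open>t\<close>, then by Brunn--Minkowski
  in \<open>\<complex>\<close> the fibre of the sumset over the sum of \<open>w\<close> and the image of \<open>w'\<close> has area more than
  \<open>(1 + |\<lambda>|)\<^sup>2 t\<close>, where \<open>\<lambda>\<close> is the new diagonal entry. The induction hypothesis is applied to the
  superlevel sets of the fibre area, and the result is integrated over \<open>t\<close>.
\<close>

no_notation Matrix.vec_index (infixl "$" 100)

section \<open>Expansion of measurable sets\<close>

text \<open>The set \<open>B\<close> is any measurable superset of \<open>S(A, A)\<close>, because the latter need not be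
  measurable itself.\<close>

definition expands :: "'a measure \<Rightarrow> ('a \<Rightarrow> 'a \<Rightarrow> 'a) \<Rightarrow> real \<Rightarrow> bool" where
  "expands M S c \<longleftrightarrow> (\<forall>A\<in>sets M. \<forall>B\<in>sets M.
     (\<forall>x\<in>A. \<forall>y\<in>A. S x y \<in> B) \<longrightarrow> ennreal c * emeasure M A \<le> emeasure M B)"

text \<open>The fibres over two base points are different sets, and lying in a superlevel set gives
  only a common lower bound on their measures. Hence two arguments and the minimum.\<close>

definition expands2 :: "'a measure \<Rightarrow> ('a \<Rightarrow> 'a \<Rightarrow> 'a) \<Rightarrow> real \<Rightarrow> bool" where
  "expands2 M R c \<longleftrightarrow> (\<forall>A\<in>sets M. \<forall>A'\<in>sets M. \<forall>B\<in>sets M.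
     (\<forall>x\<in>A. \<forall>y\<in>A'. R x y \<in> B) \<longrightarrow>
     ennreal c * min (emeasure M A) (emeasure M A') \<le> emeasure M B)"

lemma expandsD:
  assumes "expands M S c" "A \<in> sets M" "B \<in> sets M"
    and "\<And>x y. x \<in> A \<Longrightarrow> y \<in> A \<Longrightarrow> S x y \<in> B"
  shows "ennreal c * emeasure M A \<le> emeasure M B"
  using assms unfolding expands_def by blast

lemma expands2D:
  assumes "expands2 M R c" "A \<in> sets M" "A' \<in> sets M" "B \<in> sets M"
    and "\<And>x y. x \<in> A \<Longrightarrow> y \<in> A' \<Longrightarrow> R x y \<in> B"
  shows "ennreal c * min (emeasure M A) (emeasure M A') \<le> emeasure M B"
  using assms unfolding expands2_def by blast

text \<open>Preimages under a measure-preserving map that intertwines the operations keep their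
  measure and inherit the inclusion. This transports expansion between different encodings of the
  same space.\<close>

lemma expands_distr:
  assumes M: "expands M S c" and f: "f \<in> measurable M N" and N: "distr M N f = N"
    and S: "\<And>x y. x \<in> space M \<Longrightarrow> y \<in> space M \<Longrightarrow>
      S x y \<in> space M \<and> f (S x y) = S' (f x) (f y)"
  shows "expands N S' c"
  unfolding expands_def
proof (intro ballI impI)
  fix A B assume A: "A \<in> sets N" and B: "B \<in> sets N" and AB: "\<forall>x\<in>A. \<forall>y\<in>A. S' x y \<in> B"
  have e: "emeasure N X = emeasure M (f -` X \<inter> space M)" if "X \<in> sets N" for X
    using emeasure_distr[OF f that] N by simp
  have "ennreal c * emeasure M (f -` A \<inter> space M) \<le> emeasure M (f -` B \<inter> space M)"
    by (rule expandsD[OF M]) (use A B f S AB in \<open>auto intro: measurable_sets\<close>)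
  then show "ennreal c * emeasure N A \<le> emeasure N B"
    using A B e by simp
qed

text \<open>Each value \<open>a\<close> is the length of the set of \<open>t > 0\<close> below
  \<open>a\<close>, also when \<open>a\<close> is infinite; Tonelli's theorem then exchanges the two
  integrals.\<close>

lemma nn_integral_layer_cake:
  assumes "sigma_finite_measure M" and [measurable]: "f \<in> borel_measurable M"
  shows "(\<integral>\<^sup>+x. f x \<partial>M) =
    (\<integral>\<^sup>+t. indicator {0<..} t * emeasure M {x\<in>space M. ennreal t < f x} \<partial>lborel)"
proof -
  interpret M: sigma_finite_measure M by fact
  interpret pair_sigma_finite M "lborel :: real measure" by standard
  have *: "(\<integral>\<^sup>+t. indicator {t. 0 < t \<and> ennreal t < a} t \<partial>lborel) = a" for a :: ennreal
  proof (cases a)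
    case (real r)
    have "{t. 0 < t \<and> ennreal t < a} = {0<..<r}"
      using real by (auto simp: ennreal_less_iff)
    then show ?thesis using real by simp
  next
    case top
    have "{t. 0 < t \<and> ennreal t < a} = ({0<..} :: real set)"
      using top by auto
    moreover have "emeasure lborel ({0<..} :: real set) = \<infinity>"
    proof -
      have "ennreal (real n) \<le> emeasure lborel ({0<..} :: real set)" for n
        using emeasure_mono[of "{0<..<real n}" "{0<..}" lborel] by (simp add: subset_eq)
      then show ?thesis
        by (metis ennreal_of_nat_eq_real_of_nat infinity_ennreal_def not_less top.not_eq_extremum ennreal_Ex_less_of_nat)
    qed
    ultimately show ?thesis using top by simp
  qed
  have "(\<integral>\<^sup>+x. f x \<partial>M) = (\<integral>\<^sup>+x. (\<integral>\<^sup>+t. indicator {t. 0 < t \<and> ennreal t < f x} t \<partial>lborel) \<partial>M)"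
    by (simp only: *)
  also have "\<dots> = (\<integral>\<^sup>+x. (\<integral>\<^sup>+t. indicator {0<..} t * indicator {(x,t). ennreal t < f x} (x,t) \<partial>lborel) \<partial>M)"
    by (intro nn_integral_cong) (auto simp: indicator_def)
  also have "\<dots> = (\<integral>\<^sup>+t. (\<integral>\<^sup>+x. indicator {0<..} t * indicator {(x,t). ennreal t < f x} (x,t) \<partial>M) \<partial>lborel)"
    by (rule Fubini'[symmetric]) measurable
  also have "\<dots> = (\<integral>\<^sup>+t. indicator {0<..} t * (\<integral>\<^sup>+x. indicator {x\<in>space M. ennreal t < f x} x \<partial>M) \<partial>lborel)"
    by (subst nn_integral_cmult[symmetric]) (auto intro!: nn_integral_cong simp: indicator_def)
  also have "\<dots> = (\<integral>\<^sup>+t. indicator {0<..} t * emeasure M {x\<in>space M. ennreal t < f x} \<partial>lborel)"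
    by (intro nn_integral_cong arg_cong2[where f="(*)"] refl nn_integral_indicator) measurable
  finally show ?thesis .
qed

lemma borel_measurable_emeasure_superlevel:
  assumes "sigma_finite_measure M" and [measurable]: "f \<in> borel_measurable M"
  shows "(\<lambda>t. emeasure M {x\<in>space M. ennreal t < f x}) \<in> borel_measurable lborel"
proof -
  interpret M: sigma_finite_measure M by fact
  show ?thesis by measurable
qed

text \<open>This adds one coordinate. Fibres over points of a superlevel set of \<open>f\<close>
  share the lower bound \<open>t\<close>, so \<open>S\<close> sends that set into the superlevel set
  of \<open>h\<close> at the same level. The expansion of \<open>M\<close> compares the two, and the
  layer-cake formula integrates over all levels.\<close>

lemma expands_pair:
  assumes "sigma_finite_measure M" "sigma_finite_measure N"
    and M: "expands M S c" and N: "\<And>w w'. w \<in> space M \<Longrightarrow> w' \<in> space M \<Longrightarrow> expands2 N (R w w') c'"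
    and c: "0 \<le> c" "0 < c'"
  shows "expands (M \<Otimes>\<^sub>M N) (\<lambda>(w, v) (w', v'). (S w w', R w w' v v')) (c * c')"
  unfolding expands_def
proof (intro ballI impI)
  interpret M: sigma_finite_measure M by fact
  interpret N: sigma_finite_measure N by fact
  interpret pair_sigma_finite M N by standard
  fix A B assume A: "A \<in> sets (M \<Otimes>\<^sub>M N)" and B: "B \<in> sets (M \<Otimes>\<^sub>M N)"
    and AB: "\<forall>x\<in>A. \<forall>y\<in>A. (\<lambda>(w, v) (w', v'). (S w w', R w w' v v')) x y \<in> B"
  define f where "f w = emeasure N (Pair w -` A)" for w
  \<comment> \<open>Dividing by \<open>c'\<close> absorbs the fibre constant, so that
    \<open>f\<close> and \<open>h\<close> are compared at the same level.\<close>
  define h where "h w = emeasure N (Pair w -` B) / ennreal c'" for w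
  have f[measurable]: "f \<in> borel_measurable M"
    unfolding f_def by (rule N.measurable_emeasure_Pair[OF A])
  have h[measurable]: "h \<in> borel_measurable M"
    unfolding h_def using N.measurable_emeasure_Pair[OF B] by simp
  have sup: "ennreal c * emeasure M {w\<in>space M. ennreal t < f w} \<le> emeasure M {w\<in>space M. ennreal t < h w}" for t
  proof (rule expandsD[OF M])
    fix w w' assume w: "w \<in> {w\<in>space M. ennreal t < f w}" and w': "w' \<in> {w\<in>space M. ennreal t < f w}"
    have "ennreal c' * min (emeasure N (Pair w -` A)) (emeasure N (Pair w' -` A))
       \<le> emeasure N (Pair (S w w') -` B)"
      by (rule expands2D[OF N[of w w']]) (use w w' AB A B in \<open>auto intro: sets_Pair1\<close>)
    from divide_right_mono_ennreal[OF this, of "ennreal c'"]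
    have "min (f w) (f w') \<le> h (S w w')"
      using c unfolding f_def h_def
      by (simp add: mult_divide_eq_ennreal mult.commute[of "ennreal c'"])
    then have "ennreal t < h (S w w')"
      using w w' by (auto simp: min_def split: if_splits)
    \<comment> \<open>A point outside the space has an empty fibre in \<open>B\<close>, so
      \<open>h\<close> vanishes there and cannot exceed any level.\<close>
    moreover have "S w w' \<in> space M"
    proof (rule ccontr)
      assume "S w w' \<notin> space M"
      then have "Pair (S w w') -` B = {}"
        using sets.sets_into_space[OF B] by (auto simp: space_pair_measure)
      with \<open>ennreal t < h (S w w')\<close> show False by (simp add: h_def)
    qed
    ultimately show "S w w' \<in> {w\<in>space M. ennreal t < h w}" by simp
  qed measurable
  have "ennreal c * (\<integral>\<^sup>+w. f w \<partial>M) =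
     (\<integral>\<^sup>+t. ennreal c * (indicator {0<..} t * emeasure M {w\<in>space M. ennreal t < f w}) \<partial>lborel)"
    unfolding nn_integral_layer_cake[OF M.sigma_finite_measure_axioms f]
    using borel_measurable_emeasure_superlevel[OF M.sigma_finite_measure_axioms f]
    by (intro nn_integral_cmult[symmetric]) simp
  also have "\<dots> \<le> (\<integral>\<^sup>+t. indicator {0<..} t * emeasure M {w\<in>space M. ennreal t < h w} \<partial>lborel)"
    using sup by (intro nn_integral_mono) (auto simp: indicator_def)
  also have "\<dots> = (\<integral>\<^sup>+w. h w \<partial>M)"
    by (rule nn_integral_layer_cake[OF M.sigma_finite_measure_axioms h, symmetric])
  also have "\<dots> = emeasure (M \<Otimes>\<^sub>M N) B / ennreal c'"
    unfolding h_def N.emeasure_pair_measure_alt[OF B]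
    using N.measurable_emeasure_Pair[OF B] by (simp add: nn_integral_divide)
  finally have le: "ennreal c * (\<integral>\<^sup>+w. f w \<partial>M) \<le> emeasure (M \<Otimes>\<^sub>M N) B / ennreal c'" .
  have "ennreal (c * c') * emeasure (M \<Otimes>\<^sub>M N) A = ennreal c' * (ennreal c * (\<integral>\<^sup>+w. f w \<partial>M))"
    using c unfolding f_def by (simp add: N.emeasure_pair_measure_alt[OF A] ennreal_mult mult_ac)
  also have "\<dots> \<le> ennreal c' * (emeasure (M \<Otimes>\<^sub>M N) B / ennreal c')"
    by (rule mult_left_mono[OF le]) simp
  also have "\<dots> = emeasure (M \<Otimes>\<^sub>M N) B"
    using c by (simp add: ennreal_times_divide mult_divide_eq_ennreal mult.commute[of "ennreal c'"])
  finally show "ennreal (c * c') * emeasure (M \<Otimes>\<^sub>M N) A \<le> emeasure (M \<Otimes>\<^sub>M N) B" .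
qed

section \<open>Brunn--Minkowski in dimensions one and two\<close>

lemma emeasure_lborel_translate:
  fixes A :: "'a::euclidean_space set"
  assumes "A \<in> sets borel"
  shows sets_borel_translate: "(\<lambda>x. c + x) ` A \<in> sets borel"
    and "emeasure lborel ((\<lambda>x. c + x) ` A) = emeasure lborel A"
proof -
  have eq: "(\<lambda>x. c + x) ` A = (\<lambda>x. -c + x) -` A \<inter> space borel"
    by (auto simp: image_iff) (metis add.commute diff_add_cancel)
  show s: "(\<lambda>x. c + x) ` A \<in> sets borel"
    unfolding eq by (rule measurable_sets[OF _ assms]) simp
  have "emeasure lborel A = emeasure (distr lborel borel ((+) (-c))) A"
    by (simp add: lborel_distr_plus)
  also have "\<dots> = emeasure lborel ((\<lambda>x. c + x) ` A)"
    using assms by (subst emeasure_distr) (auto simp: eq vimage_def)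
  finally show "emeasure lborel ((\<lambda>x. c + x) ` A) = emeasure lborel A" ..
qed

text \<open>Shift \<open>A\<close> by an almost minimal point \<open>b\<close> of \<open>B\<close>,
  and \<open>B\<close> by an almost maximal point \<open>a\<close> of \<open>A\<close>. Both shifts
  lie in \<open>C\<close>, and they overlap only in an interval of length \<open>e\<close> around
  \<open>a + b\<close>.\<close>

lemma emeasure_lborel_add_bounded:
  fixes A B C :: "real set"
  assumes [measurable]: "A \<in> sets borel" "B \<in> sets borel" "C \<in> sets borel"
    and ne: "A \<noteq> {}" "B \<noteq> {}" and bd: "bounded A" "bounded B"
    and C: "\<And>x y. x \<in> A \<Longrightarrow> y \<in> B \<Longrightarrow> x + y \<in> C"
  shows "emeasure lborel A + emeasure lborel B \<le> emeasure lborel C"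
proof (rule ennreal_le_epsilon)
  fix e :: real assume "0 < e"
  have "Sup A - e / 2 < Sup A" "Inf B < Inf B + e / 2" using \<open>0 < e\<close> by auto
  then obtain a b where a: "a \<in> A" "Sup A - e / 2 < a" and b: "b \<in> B" "b < Inf B + e / 2"
    using less_cSup_iff[OF ne(1), of "Sup A - e/2"] cInf_less_iff[OF ne(2), of "Inf B + e/2"]
      bounded_imp_bdd_above[OF bd(1)] bounded_imp_bdd_below[OF bd(2)] by blast
  let ?X = "(\<lambda>x. b + x) ` A" and ?Y = "(\<lambda>x. a + x) ` B"
  have XY[measurable]: "?X \<in> sets lborel" "?Y \<in> sets lborel"
    by (auto intro!: sets_borel_translate assms)
  have "?X \<inter> ?Y \<subseteq> {a + b - e / 2 .. a + b + e / 2}"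
  proof
    fix z assume "z \<in> ?X \<inter> ?Y"
    then obtain x y where "x \<in> A" "z = b + x" "y \<in> B" "z = a + y" by auto
    moreover have "x \<le> Sup A" "Inf B \<le> y"
      using \<open>x \<in> A\<close> \<open>y \<in> B\<close> bd
      by (auto intro!: cSup_upper cInf_lower bounded_imp_bdd_above bounded_imp_bdd_below)
    ultimately show "z \<in> {a + b - e / 2 .. a + b + e / 2}" using a b by auto
  qed
  then have int: "emeasure lborel (?X \<inter> ?Y) \<le> ennreal e"
    using emeasure_mono[of "?X \<inter> ?Y" "{a + b - e / 2 .. a + b + e / 2}" lborel] \<open>0 < e\<close> by simp
  have "emeasure lborel A + emeasure lborel B = emeasure lborel ?X + emeasure lborel ?Y"
    using emeasure_lborel_translate(2) assms(1,2) by metis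
  also have "\<dots> = emeasure lborel (?X \<union> ?Y) + emeasure lborel (?X \<inter> ?Y)"
    by (rule emeasure_Un_Int) (use XY in auto)
  also have "\<dots> \<le> emeasure lborel C + ennreal e"
    by (intro add_mono int emeasure_mono) (use a b C in \<open>auto simp: add.commute[of b]\<close>)
  finally show "emeasure lborel A + emeasure lborel B \<le> emeasure lborel C + ennreal e" .
qed

lemma emeasure_truncation_tendsto:
  fixes A :: "'a::euclidean_space set"
  assumes [measurable]: "A \<in> sets borel"
  shows "(\<lambda>n. emeasure lborel (A \<inter> cball 0 (real n))) \<longlonglongrightarrow> emeasure lborel A"
proof -
  have "(\<lambda>n. emeasure lborel (A \<inter> cball 0 (real n))) \<longlonglongrightarrow> emeasure lborel (\<Union>n. A \<inter> cball 0 (real n))"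
    by (rule Lim_emeasure_incseq) (auto simp: incseq_def)
  also have "(\<Union>n. A \<inter> cball 0 (real n)) = A"
    using real_arch_simple by (auto simp: )
  finally show ?thesis .
qed

text \<open>Exhaustion by balls reduces the claim to bounded sets, since sums of truncated sets
  still lie in \<open>C\<close>.\<close>

lemma emeasure_lborel_add:
  fixes A B C :: "real set"
  assumes [measurable]: "A \<in> sets borel" "B \<in> sets borel" "C \<in> sets borel"
    and ne: "A \<noteq> {}" "B \<noteq> {}"
    and C: "\<And>x y. x \<in> A \<Longrightarrow> y \<in> B \<Longrightarrow> x + y \<in> C"
  shows "emeasure lborel A + emeasure lborel B \<le> emeasure lborel C"
proof (rule tendsto_upperbound)
  show "(\<lambda>n. emeasure lborel (A \<inter> cball 0 (real n)) + emeasure lborel (B \<inter> cball 0 (real n)))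
    \<longlonglongrightarrow> emeasure lborel A + emeasure lborel B"
    by (intro tendsto_add emeasure_truncation_tendsto assms)
  obtain a b where ab: "a \<in> A" "b \<in> B" using ne by auto
  \<comment> \<open>From radius \<open>m\<close> on, both truncations contain a point, as the
    bounded case demands.\<close>
  obtain m :: nat where m: "max \<bar>a\<bar> \<bar>b\<bar> \<le> real m" using real_arch_simple by blast
  show "\<forall>\<^sub>F n in sequentially. emeasure lborel (A \<inter> cball 0 (real n)) + emeasure lborel (B \<inter> cball 0 (real n))
    \<le> emeasure lborel C"
    using eventually_ge_at_top[of m]
  proof eventually_elim
    case (elim n)
    have "a \<in> A \<inter> cball 0 (real n)" "b \<in> B \<inter> cball 0 (real n)" using ab m elim by auto
    then show ?case
      by (intro emeasure_lborel_add_bounded) (auto intro: C bounded_subset[OF bounded_cball])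
  qed
qed simp

text \<open>With \<open>p\<close> and \<open>q\<close> the suprema of the fibre lengths \<open>f\<close> of \<open>A\<close> and \<open>g\<close> of \<open>B\<close>, the superlevel
  sets of \<open>f / p\<close> and \<open>g / q\<close> are nonempty at the same levels \<open>t < 1\<close>, so the one-dimensional
  inequality applies to them; Cauchy--Schwarz then removes \<open>p\<close> and \<open>q\<close>.\<close>

lemma brunn_minkowski_plane:
  fixes A B C :: "(real \<times> real) set"
  assumes A0: "A \<in> sets (lborel \<Otimes>\<^sub>M lborel)" and B0: "B \<in> sets (lborel \<Otimes>\<^sub>M lborel)"
    and C: "C \<in> sets (lborel \<Otimes>\<^sub>M lborel)"
    and AB: "\<And>x y. x \<in> A \<Longrightarrow> y \<in> B \<Longrightarrow> x + y \<in> C"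
    and ab: "0 < a" "0 < b" "ennreal a < emeasure (lborel \<Otimes>\<^sub>M lborel) A" "ennreal b < emeasure (lborel \<Otimes>\<^sub>M lborel) B"
  shows "ennreal ((sqrt a + sqrt b)\<^sup>2) \<le> emeasure (lborel \<Otimes>\<^sub>M lborel) C"
proof -
  let ?L = "lborel :: real measure" and ?LL = "(lborel :: real measure) \<Otimes>\<^sub>M (lborel :: real measure)"
  \<comment> \<open>Truncation to a large ball keeps the strict bound on the area and makes all
    fibre lengths bounded, so that the suprema \<open>p\<close> and \<open>q\<close> are
    finite.\<close>
  have trunc: "\<exists>A'\<subseteq>A. A' \<in> sets ?LL \<and> bounded A' \<and> ennreal a < emeasure ?LL A'"
    if A: "A \<in> sets ?LL" "ennreal a < emeasure ?LL A" for A a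
  proof -
    have "\<forall>\<^sub>F n in sequentially. ennreal a < emeasure ?LL (A \<inter> cball 0 (real n))"
      using emeasure_truncation_tendsto[of A] A by (intro order_tendstoD) (auto simp: lborel_prod borel_prod[symmetric])
    then obtain n where "ennreal a < emeasure ?LL (A \<inter> cball 0 (real n))"
      by (auto simp: eventually_sequentially)
    moreover have "A \<inter> cball 0 (real n) \<in> sets ?LL"
      using A(1) unfolding lborel_prod sets_lborel by auto
    ultimately show ?thesis by (intro exI[of _ "A \<inter> cball 0 (real n)"]) auto
  qed
  obtain A' where A': "A' \<subseteq> A" "A' \<in> sets ?LL" "bounded A'" "ennreal a < emeasure ?LL A'"
    using trunc[OF A0 ab(3)] by auto
  obtain B' where B': "B' \<subseteq> B" "B' \<in> sets ?LL" "bounded B'" "ennreal b < emeasure ?LL B'"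
    using trunc[OF B0 ab(4)] by auto
  define f where "f x = emeasure ?L (Pair x -` A')" for x
  define g where "g x = emeasure ?L (Pair x -` B')" for x
  define h where "h x = emeasure ?L (Pair x -` C)" for x
  have [measurable]: "f \<in> borel_measurable ?L" "g \<in> borel_measurable ?L" "h \<in> borel_measurable ?L"
    unfolding f_def g_def h_def using A' B' C by (auto intro!: lborel.measurable_emeasure_Pair)
  have If: "emeasure ?LL A' = (\<integral>\<^sup>+x. f x \<partial>?L)" and Ig: "emeasure ?LL B' = (\<integral>\<^sup>+x. g x \<partial>?L)"
    and Ih: "emeasure ?LL C = (\<integral>\<^sup>+x. h x \<partial>?L)"
    unfolding f_def g_def h_def using A' B' C by (auto simp: lborel.emeasure_pair_measure_alt)
  have fin: "\<exists>p>0. (SUP x. emeasure ?L (Pair x -` X)) = ennreal p"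
    if X: "X \<in> sets ?LL" "bounded X" "emeasure ?LL X > ennreal a" for X a
  proof -
    obtain r where r: "\<And>z. z \<in> X \<Longrightarrow> norm z \<le> r" "0 < r" using \<open>bounded X\<close> bounded_pos by blast
    have "Pair x -` X \<subseteq> {-r..r}" for x
    proof
      fix y assume "y \<in> Pair x -` X"
      then have "norm y \<le> r" using r(1)[of "(x, y)"] norm_snd_le[of y x] by simp
      then show "y \<in> {-r..r}" by (simp add: abs_le_iff)
    qed
    then have "emeasure ?L (Pair x -` X) \<le> ennreal (2 * r)" for x
      using emeasure_mono[of "Pair x -` X" "{-r..r}" ?L] r(2) by simp
    then have "(SUP x. emeasure ?L (Pair x -` X)) \<le> ennreal (2 * r)" by (intro SUP_least)
    then obtain p where p: "(SUP x. emeasure ?L (Pair x -` X)) = ennreal p" "0 \<le> p"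
      by (metis ennreal_cases ennreal_less_top leD top.not_eq_extremum)
    \<comment> \<open>If all fibres were null, Fubini would give area zero, against the strict lower
      bound.\<close>
    have "p \<noteq> 0"
    proof
      assume "p = 0"
      then have "emeasure ?L (Pair x -` X) \<le> 0" for x using p by (metis SUP_upper UNIV_I ennreal_0)
      then have "emeasure ?LL X = 0" using X by (simp add: lborel.emeasure_pair_measure_alt)
      then show False using X by simp
    qed
    with p show ?thesis by (intro exI[of _ p]) auto
  qed
  obtain p where p: "p > 0" "(SUP x. f x) = ennreal p"
    using fin[OF A'(2,3,4)] unfolding f_def by auto
  obtain q where q: "q > 0" "(SUP x. g x) = ennreal q"
    using fin[OF B'(2,3,4)] unfolding g_def by auto
  have sc: "(ennreal t < u / ennreal p) \<longleftrightarrow> (ennreal (t * p) < u)" if "0 < p" "0 < t" for t p u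
    using that by (cases u) (auto simp: divide_ennreal ennreal_less_iff field_simps ennreal_top_divide)
  have lvl: "emeasure ?L {x\<in>space ?L. ennreal t < f x / p} + emeasure ?L {x\<in>space ?L. ennreal t < g x / q}
      \<le> emeasure ?L {x\<in>space ?L. ennreal t < h x / (p + q)}" (is "emeasure ?L ?F + emeasure ?L ?G \<le> emeasure ?L ?H")
    if t: "0 < t" for t
  proof (cases "t < 1")
    case True
    have "ennreal (t * p) < (SUP x. f x)" "ennreal (t * q) < (SUP x. g x)"
      using p q t True by (auto simp: ennreal_less_iff)
    then obtain x0 y0 where "ennreal (t * p) < f x0" "ennreal (t * q) < g y0"
      unfolding less_SUP_iff by blast
    then have ne: "?F \<noteq> {}" "?G \<noteq> {}"
      using t p q by (auto simp: sc)
    show ?thesis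
    proof (rule emeasure_lborel_add[OF _ _ _ ne])
      fix x y assume "x \<in> ?F" "y \<in> ?G"
      then have f: "ennreal (t * p) < f x" and g: "ennreal (t * q) < g y"
        using t p q by (auto simp: sc)
      \<comment> \<open>These fibres have positive length, so the one-dimensional inequality also
        applies in the second coordinate.\<close>
      have "Pair x -` A' \<noteq> {}" "Pair y -` B' \<noteq> {}"
        using f g by (auto simp: f_def g_def simp del: vimage_eq)
      then have "f x + g y \<le> h (x + y)"
        unfolding f_def g_def h_def
        using A' B' C AB by (intro emeasure_lborel_add) (auto dest: sets_Pair1 simp: subset_eq)
      \<comment> \<open>The two strict bounds add up to \<open>t * (p + q)\<close>; this is why
        \<open>h\<close> is normalised by \<open>p + q\<close>.\<close>
      moreover have "ennreal (t * (p + q)) < f x + g y"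
        using add_strict_mono[OF f g] p q t by (simp add: distrib_left ennreal_plus[symmetric] del: ennreal_plus)
      ultimately show "x + y \<in> ?H"
        using t p q by (auto simp: sc simp del: ennreal_plus)
    qed measurable
  next
    case False
    \<comment> \<open>The normalised functions are at most 1, so both superlevel sets are empty from
      level 1 on.\<close>
    have "f x \<le> ennreal p" "g x \<le> ennreal q" for x
      using p q SUP_upper[of x UNIV f] SUP_upper[of x UNIV g] by auto
    moreover have "ennreal p \<le> ennreal (t * p)" "ennreal q \<le> ennreal (t * q)"
      using False p q by (auto intro!: ennreal_leI)
    ultimately have "f x \<le> ennreal (t * p)" "g x \<le> ennreal (t * q)" for x
      by (meson order_trans)+
    then have "?F = {}" "?G = {}" using t p q by (auto simp: sc not_less)
    then show ?thesis by simp
  qed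
  note layer = nn_integral_layer_cake[OF sigma_finite_lborel]
  note meas = borel_measurable_emeasure_superlevel[OF sigma_finite_lborel]
  have "emeasure ?LL A' / p + emeasure ?LL B' / q = (\<integral>\<^sup>+x. f x / p \<partial>?L) + (\<integral>\<^sup>+x. g x / q \<partial>?L)"
    by (simp add: If Ig nn_integral_divide)
  also have "\<dots> = (\<integral>\<^sup>+t. indicator {0<..} t * emeasure ?L {x\<in>space ?L. ennreal t < f x / p}
     + indicator {0<..} t * emeasure ?L {x\<in>space ?L. ennreal t < g x / q} \<partial>lborel)"
    by (subst (1 2) layer, measurable, subst nn_integral_add) (use meas in auto)
  also have "\<dots> \<le> (\<integral>\<^sup>+t. indicator {0<..} t * emeasure ?L {x\<in>space ?L. ennreal t < h x / (p + q)} \<partial>lborel)"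
    using lvl by (intro nn_integral_mono) (auto simp: indicator_def)
  also have "\<dots> = (\<integral>\<^sup>+x. h x / (p + q) \<partial>?L)"
    by (rule layer[symmetric]) measurable
  also have "\<dots> = emeasure ?LL C / (p + q)"
    by (simp add: Ih nn_integral_divide)
  finally have *: "emeasure ?LL A' / p + emeasure ?LL B' / q \<le> emeasure ?LL C / (p + q)" .
  have "(sqrt a + sqrt b)\<^sup>2 \<le> (p + q) * (a / p + b / q)"
  proof -
    \<comment> \<open>The deficit in the Cauchy--Schwarz inequality is exactly this square.\<close>
    have "0 \<le> (q * sqrt a - p * sqrt b)\<^sup>2 / (p * q)" using p q by simp
    also have "\<dots> = (p + q) * (a / p + b / q) - (sqrt a + sqrt b)\<^sup>2"
      using p q ab by (simp add: field_simps power2_eq_square)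
    finally show ?thesis by simp
  qed
  then have "ennreal ((sqrt a + sqrt b)\<^sup>2) \<le> ennreal ((p + q) * (a / p + b / q))" by (rule ennreal_leI)
  also have "\<dots> = ennreal (p + q) * (ennreal a / p + ennreal b / q)"
    using p q ab by (simp add: ennreal_mult divide_ennreal ennreal_plus[symmetric] del: ennreal_plus)
  also have "\<dots> \<le> ennreal (p + q) * (emeasure ?LL A' / p + emeasure ?LL B' / q)"
    using A' B' by (intro mult_left_mono add_mono divide_right_mono_ennreal) auto
  also have "\<dots> \<le> ennreal (p + q) * (emeasure ?LL C / (p + q))"
    by (rule mult_left_mono[OF *]) simp
  also have "\<dots> = emeasure ?LL C"
    using p q by (simp add: ennreal_times_divide mult_divide_eq_ennreal mult.commute[of "ennreal (p + q)"] del: ennreal_plus)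
  finally show ?thesis .
qed

section \<open>Linear changes of variables\<close>

lemma emeasure_lborel_box_cart:
  fixes l u :: "real ^ 'm"
  assumes "\<And>i. l $ i \<le> u $ i"
  shows "emeasure lborel (box l u) = ennreal (\<Prod>i\<in>UNIV. u $ i - l $ i)"
proof -
  have "emeasure lborel (box l u) = emeasure lborel (cbox l u)"
    by (simp add: emeasure_lborel_box_eq emeasure_lborel_cbox_eq)
  also have "\<dots> = ennreal (measure lborel (cbox l u))"
    by (rule emeasure_eq_ennreal_measure) (use emeasure_lborel_cbox_finite[of l u] in auto)
  also have "measure lborel (cbox l u) = (\<Prod>i\<in>UNIV. u $ i - l $ i)"
    using assms by (intro content_cbox_cart) (simp add: interval_ne_empty_cart)
  finally show ?thesis .
qed

text \<open>Uniqueness of Haar measure by Fubini: the measure of \<open>{(y, x). y \<in> U \<and> y + x \<in> A}\<close> is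
  computed in both orders. The symmetry of \<open>U\<close> spares a reflection of the measures.\<close>

lemma translation_invariant_proportional:
  fixes N :: "'a::euclidean_space measure"
  assumes "sigma_finite_measure N" and sets[measurable_cong]: "sets N = sets borel"
    and inv: "\<And>c A. A \<in> sets borel \<Longrightarrow> emeasure N ((\<lambda>x. c + x) -` A) = emeasure N A"
    and U[measurable]: "U \<in> sets borel" and sym: "\<And>x. - x \<in> U \<longleftrightarrow> x \<in> U"
    and A[measurable]: "A \<in> sets borel"
  shows "emeasure N U * emeasure lborel A = emeasure lborel U * emeasure N A"
proof -
  interpret N: sigma_finite_measure N by fact
  interpret pair_sigma_finite N "lborel :: 'a measure" by standard
  have L: "emeasure lborel ((\<lambda>x. c + x) -` X) = emeasure lborel X" if "X \<in> sets borel" for c :: 'a and X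
    using emeasure_distr[of "(+) c" lborel borel X] that by (simp add: lborel_distr_plus)
  have space: "space N = UNIV" using sets_eq_imp_space_eq[OF sets] by simp
  have int: "(\<integral>\<^sup>+x. indicator X x \<partial>M) = emeasure M X" if "X \<in> sets M" for X and M :: "'a measure"
    using that by simp
  have [measurable]: "(\<lambda>x. y + x) -` X \<in> sets borel" if "X \<in> sets borel" for y :: 'a and X
    using measurable_sets[of "(\<lambda>x::'a. y + x)" borel borel X] that by simp
  \<comment> \<open>Invariance of \<open>lborel\<close> lets the constant factor be replaced by the
    measure of a translate of \<open>A\<close> that depends on \<open>y\<close>.\<close>
  have "emeasure N U * emeasure lborel A = (\<integral>\<^sup>+y. emeasure lborel ((\<lambda>x. y + x) -` A) * indicator U y \<partial>N)"
    unfolding L[OF A] by (subst nn_integral_cmult_indicator) (auto simp: sets mult.commute)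
  also have "\<dots> = (\<integral>\<^sup>+y. (\<integral>\<^sup>+x. indicator A (y + x) * indicator U y \<partial>lborel) \<partial>N)"
    by (intro nn_integral_cong, subst nn_integral_multc)
      (auto simp: nn_integral_indicator[symmetric] indicator_def vimage_def intro!: arg_cong2[where f="(*)"] nn_integral_cong simp del: nn_integral_indicator)
  also have "\<dots> = (\<integral>\<^sup>+x. (\<integral>\<^sup>+y. indicator A (y + x) * indicator U y \<partial>N) \<partial>lborel)"
    by (rule Fubini'[symmetric]) measurable
  also have "\<dots> = (\<integral>\<^sup>+x. (\<integral>\<^sup>+y. indicator A y * indicator U (x - y) \<partial>N) \<partial>lborel)"
  proof (rule nn_integral_cong)
    fix x :: 'a
    have [measurable]: "{y \<in> A. x - y \<in> U} \<in> sets borel" by measurable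
    \<comment> \<open>Substituting \<open>x + y\<close> for \<open>y\<close> turns
      \<open>x - y\<close> into \<open>- y\<close>, which symmetry of \<open>U\<close> turns back
      into \<open>y\<close>.\<close>
    have eq: "{y. y + x \<in> A \<and> y \<in> U} = (\<lambda>y. x + y) -` {y \<in> A. x - y \<in> U}"
      using sym by (auto simp: add.commute)
    have "(\<integral>\<^sup>+y. indicator A (y + x) * indicator U y \<partial>N) = (\<integral>\<^sup>+y. indicator {y. y + x \<in> A \<and> y \<in> U} y \<partial>N)"
      by (intro nn_integral_cong) (auto simp: indicator_def)
    also have "\<dots> = emeasure N {y. y + x \<in> A \<and> y \<in> U}"
      by (rule int) (simp add: eq sets)
    also have "\<dots> = emeasure N {y \<in> A. x - y \<in> U}"
      unfolding eq by (rule inv) measurable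
    also have "\<dots> = (\<integral>\<^sup>+y. indicator {y \<in> A. x - y \<in> U} y \<partial>N)"
      by (rule int[symmetric]) (simp add: sets)
    also have "\<dots> = (\<integral>\<^sup>+y. indicator A y * indicator U (x - y) \<partial>N)"
      by (intro nn_integral_cong) (auto simp: indicator_def)
    finally show "(\<integral>\<^sup>+y. indicator A (y + x) * indicator U y \<partial>N) = \<dots>" .
  qed
  also have "\<dots> = (\<integral>\<^sup>+y. (\<integral>\<^sup>+x. indicator A y * indicator U (x - y) \<partial>lborel) \<partial>N)"
    by (rule Fubini') measurable
  also have "\<dots> = (\<integral>\<^sup>+y. emeasure lborel U * indicator A y \<partial>N)"
  proof (intro nn_integral_cong)
    fix y :: 'a
    have U': "(\<lambda>x. - y + x) -` U \<in> sets lborel" by measurable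
    have "(\<integral>\<^sup>+x. indicator A y * indicator U (x - y) \<partial>lborel)
        = indicator A y * (\<integral>\<^sup>+x. indicator ((\<lambda>x. - y + x) -` U) x \<partial>lborel)"
      by (subst nn_integral_cmult[symmetric]) (auto intro!: nn_integral_cong simp: indicator_def)
    also have "\<dots> = emeasure lborel U * indicator A y"
      by (simp only: int[OF U'] L[OF U] mult.commute)
    finally show "(\<integral>\<^sup>+x. indicator A y * indicator U (x - y) \<partial>lborel) = \<dots>" .
  qed
  also have "\<dots> = emeasure lborel U * emeasure N A"
    by (simp add: nn_integral_cmult_indicator)
  finally show ?thesis .
qed

text \<open>The image of Lebesgue measure under \<open>f\<close> is translation invariant, hence
  proportional to Lebesgue measure. The unit ball, a symmetric set, serves to express the
  constant.\<close>

lemma emeasure_lborel_linear_vimage: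
  fixes f :: "'a::euclidean_space \<Rightarrow> 'a"
  assumes f: "linear f" and inj: "inj f" and A: "A \<in> sets borel"
  shows "emeasure lborel (f -` ball 0 1) * emeasure lborel A =
    emeasure lborel (ball 0 1 :: 'a set) * emeasure lborel (f -` A)"
proof -
  let ?N = "distr lborel borel f"
  have m[measurable]: "f \<in> borel_measurable borel"
    using f by (intro borel_measurable_continuous_onI linear_continuous_on) (simp add: linear_linear)
  have surj: "surj f" using f inj by (rule linear_inj_imp_surj)
  define g where "g = inv_into UNIV f"
  have g: "linear g" "\<And>x. g (f x) = x" "\<And>x. f (g x) = x"
    using inj_linear_imp_inv_linear[OF f inj] by (simp_all add: g_def inv_f_f[OF inj] surj_f_inv_f[OF surj])
  have mg: "g \<in> borel_measurable borel"
    using g(1) by (intro borel_measurable_continuous_onI linear_continuous_on) (simp add: linear_linear)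
  have N: "emeasure ?N X = emeasure lborel (f -` X)" if "X \<in> sets borel" for X
    using that by (simp add: emeasure_distr)
  have [measurable]: "f -` X \<in> sets borel" if "X \<in> sets borel" for X
    using measurable_sets[OF m that] by simp
  have "emeasure ?N (ball 0 1) * emeasure lborel A = emeasure lborel (ball 0 1 :: 'a set) * emeasure ?N A"
  proof (rule translation_invariant_proportional)
    show "sigma_finite_measure ?N"
    proof (rule sigma_finite_measure_distr)
      \<comment> \<open>Pushing \<open>?N\<close> forward along the inverse \<open>g\<close> returns
        \<open>lborel\<close>, and sigma-finiteness of an image measure passes to its
        source.\<close>
      have "distr ?N borel g = distr lborel borel (\<lambda>x. x)"
        using m mg by (subst distr_distr) (simp_all add: comp_def g)
      also have "\<dots> = lborel" by (rule distr_id2) simp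
      finally show "sigma_finite_measure (distr ?N borel g)" by (simp add: sigma_finite_lborel)
    qed (use mg in simp)
    fix c X assume X: "X \<in> sets (borel :: 'a measure)"
    have X': "(\<lambda>x. c + x) -` X \<in> sets borel"
      using measurable_sets[of "(\<lambda>x::'a. c + x)" borel borel X] X by simp
    \<comment> \<open>A shift by \<open>c\<close> in the image is a shift by \<open>g c\<close> in
      the source.\<close>
    have eq: "f -` ((\<lambda>x. c + x) -` X) = (\<lambda>x. g c + x) -` (f -` X)"
      by (auto simp: linear_add[OF f] g)
    have "emeasure lborel ((\<lambda>x. g c + x) -` (f -` X)) = emeasure lborel (f -` X)"
      using emeasure_distr[of "(+) (g c)" lborel borel "f -` X"] X by (simp add: lborel_distr_plus)
    then show "emeasure ?N ((\<lambda>x. c + x) -` X) = emeasure ?N X"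
      by (simp add: N X X' eq)
  qed (use A in auto)
  then show ?thesis by (simp add: N A)
qed

text \<open>Preimages under \<open>f\<close> scale all volumes by one factor, which cancels from the
  inequality because it is neither zero nor infinite.\<close>

lemma expands_lborel_linear:
  fixes f :: "'a::euclidean_space \<Rightarrow> 'a"
  assumes f: "linear f" "inj f" and S: "expands lborel S c"
    and SS': "\<And>x y. f (S x y) = S' (f x) (f y)"
  shows "expands lborel S' c"
  unfolding expands_def
proof (intro ballI impI)
  fix A B :: "'a set" assume "A \<in> sets lborel" "B \<in> sets lborel" and AB: "\<forall>x\<in>A. \<forall>y\<in>A. S' x y \<in> B"
  then have A: "A \<in> sets borel" and B: "B \<in> sets borel" by auto
  let ?b = "emeasure lborel (ball 0 1 :: 'a set)" and ?k = "emeasure lborel (f -` ball 0 1)"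
  have m: "f \<in> borel_measurable borel"
    using f by (intro borel_measurable_continuous_onI linear_continuous_on) (simp add: linear_linear)
  note scale = emeasure_lborel_linear_vimage[OF f]
  have "?k \<noteq> 0"
  proof
    \<comment> \<open>Scaling the whole space would equate zero with a positive multiple of
      infinity.\<close>
    assume "?k = 0"
    then show False using scale[of UNIV] unit_ball_vol_pos[of "real DIM('a)"] by (simp add: emeasure_ball)
  qed
  moreover have "?k \<noteq> \<infinity>"
  proof -
    \<comment> \<open>A left inverse bounds the preimage of the ball by the image of the ball under
      a linear map, which is bounded.\<close>
    obtain g where g: "linear g" "g \<circ> f = id" using linear_injective_left_inverse[OF f] by auto
    have "f -` ball 0 1 \<subseteq> g ` ball 0 1" using g(2) by (auto simp: fun_eq_iff intro!: image_eqI[where x="f _"])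
    moreover have "bounded (g ` ball 0 1)"
      using g(1) by (intro bounded_linear_image) (auto simp: linear_linear)
    ultimately show ?thesis using emeasure_bounded_finite bounded_subset by (metis less_irrefl infinity_ennreal_def)
  qed
  moreover have "?k * (ennreal c * emeasure lborel A) \<le> ?k * emeasure lborel B"
  proof -
    have "ennreal c * emeasure lborel (f -` A) \<le> emeasure lborel (f -` B)"
      by (rule expandsD[OF S]) (use measurable_sets[OF m A] measurable_sets[OF m B] AB in \<open>auto simp: SS'\<close>)
    then have "?b * (ennreal c * emeasure lborel (f -` A)) \<le> ?b * emeasure lborel (f -` B)"
      by (rule mult_left_mono) simp
    then show ?thesis using scale[OF A] scale[OF B] by (metis mult.left_commute)
  qed
  ultimately show "ennreal c * emeasure lborel A \<le> emeasure lborel B"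
    by (simp add: ennreal_mult_le_mult_iff)
qed

section \<open>The complex line\<close>

lemma emeasure_lborel_box_complex:
  assumes "Re l \<le> Re u" "Im l \<le> Im u"
  shows "emeasure lborel (box l u) = ennreal ((Re u - Re l) * (Im u - Im l))"
  using assms by (subst emeasure_lborel_box) (auto simp: Basis_complex_def)

lemma lborel_eqI_complex:
  fixes M :: "complex measure"
  assumes "\<And>l u. Re l \<le> Re u \<Longrightarrow> Im l \<le> Im u \<Longrightarrow> emeasure M (box l u) = ennreal ((Re u - Re l) * (Im u - Im l))"
    and "sets M = sets borel"
  shows "M = lborel"
proof (rule lborel_eqI[symmetric])
  fix l u :: complex assume "\<And>b. b \<in> Basis \<Longrightarrow> l \<bullet> b \<le> u \<bullet> b"
  from this[of 1] this[of \<i>] show "emeasure M (box l u) = ennreal (\<Prod>b\<in>Basis. (u - l) \<bullet> b)"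
    by (subst assms(1)) (auto simp: Basis_complex_def)
qed fact

lemma mem_box_complex: "z \<in> box l u \<longleftrightarrow> Re l < Re z \<and> Re z < Re u \<and> Im l < Im z \<and> Im z < Im u"
  by (auto simp: box_def Basis_complex_def)

lemma borel_measurable_Complex [measurable]:
  assumes [measurable]: "f \<in> borel_measurable M" "g \<in> borel_measurable M"
  shows "(\<lambda>x. Complex (f x) (g x)) \<in> borel_measurable M"
  unfolding Complex_eq by measurable

lemma lborel_complex_pair:
  "distr (lborel \<Otimes>\<^sub>M lborel) borel (\<lambda>(a, b). Complex a b) = lborel"
proof (rule lborel_eqI_complex)
  fix l u :: complex assume "Re l \<le> Re u" "Im l \<le> Im u"
  moreover have "(\<lambda>(a, b). Complex a b) -` box l u = {Re l <..< Re u} \<times> {Im l <..< Im u}"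
    by (auto simp: mem_box_complex)
  ultimately show "emeasure (distr (lborel \<Otimes>\<^sub>M lborel) borel (\<lambda>(a, b). Complex a b)) (box l u)
     = ennreal ((Re u - Re l) * (Im u - Im l))"
    by (subst emeasure_distr) (auto simp: space_pair_measure lborel.emeasure_pair_measure_Times ennreal_mult)
qed simp

text \<open>The scaling constant is read off from the unit disc, whose preimage is the disc of
  radius \<open>cmod c\<close>.\<close>

lemma emeasure_lborel_times_complex:
  fixes c :: complex
  assumes c: "c \<noteq> 0" and A: "A \<in> sets borel"
  shows "emeasure lborel ((\<lambda>z. inverse c * z) -` A) = ennreal ((cmod c)\<^sup>2) * emeasure lborel A"
proof -
  have ball: "(\<lambda>z. inverse c * z) -` ball 0 1 = ball 0 (cmod c)"
    using c by (auto simp: norm_mult norm_inverse norm_divide field_simps)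
  have lin: "linear (\<lambda>z. inverse c * z)" "inj (\<lambda>z. inverse c * z)"
    using c by (auto intro!: linearI injI simp: algebra_simps)
  have "ennreal pi * emeasure lborel ((\<lambda>z. inverse c * z) -` A)
      = ennreal pi * (ennreal ((cmod c)\<^sup>2) * emeasure lborel A)"
    using emeasure_lborel_linear_vimage[OF lin A]
    unfolding ball by (simp add: emeasure_ball unit_ball_vol_2 ennreal_mult mult_ac)
  then show ?thesis by (simp add: ennreal_mult_cancel_left)
qed

text \<open>The planar inequality carries over because \<open>Complex\<close> preserves sums and
  area. The levels \<open>a\<close> and \<open>b\<close> are real numbers below the areas, so square
  roots are taken of finite values only.\<close>

lemma brunn_minkowski_complex:
  fixes A B C :: "complex set"
  assumes [measurable]: "A \<in> sets borel" "B \<in> sets borel" "C \<in> sets borel"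
    and AB: "\<And>x y. x \<in> A \<Longrightarrow> y \<in> B \<Longrightarrow> x + y \<in> C"
    and ab: "0 < a" "0 < b" "ennreal a < emeasure lborel A" "ennreal b < emeasure lborel B"
  shows "ennreal ((sqrt a + sqrt b)\<^sup>2) \<le> emeasure lborel C"
proof -
  define p where "p = (\<lambda>(a, b). Complex a b)"
  have m: "p \<in> borel_measurable (lborel \<Otimes>\<^sub>M lborel)" unfolding p_def by measurable
  have p: "emeasure lborel X = emeasure (lborel \<Otimes>\<^sub>M lborel) (p -` X)"
    "p -` X \<in> sets (lborel \<Otimes>\<^sub>M lborel)" if "X \<in> sets borel" for X
    using emeasure_distr[OF m that] measurable_sets[OF m that] lborel_complex_pair
    by (auto simp: p_def space_pair_measure)
  have "p (x + y) = p x + p y" for x y by (auto simp: p_def complex_eq_iff split: prod.split)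
  then show ?thesis
    using ab unfolding p(1)[OF assms(1)] p(1)[OF assms(2)] p(1)[OF assms(3)]
    by (intro brunn_minkowski_plane[OF p(2)[OF assms(1)] p(2)[OF assms(2)] p(2)[OF assms(3)]])
      (auto simp: AB)
qed

text \<open>Brunn--Minkowski is applied to \<open>A\<close> and \<open>D = s + l A'\<close>, whose
  area is \<open>|l|^2\<close> times that of \<open>A'\<close>. At a common level \<open>a\<close>
  the bound becomes \<open>(sqrt a + |l| sqrt a)^2 = (1 + |l|)^2 a\<close>. The shift
  \<open>s\<close> carries what the earlier coordinates contribute.\<close>

lemma expands2_complex:
  "expands2 lborel (\<lambda>v v'. v + (s + l * v')) ((1 + cmod l)\<^sup>2)"
  unfolding expands2_def
proof (intro ballI impI)
  fix A A' B :: "complex set"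
  assume "A \<in> sets lborel" "A' \<in> sets lborel" "B \<in> sets lborel"
    and AB: "\<forall>v\<in>A. \<forall>v'\<in>A'. v + (s + l * v') \<in> B"
  then have S[measurable]: "A \<in> sets borel" "A' \<in> sets borel" "B \<in> sets borel" by auto
  show "ennreal ((1 + cmod l)\<^sup>2) * min (emeasure lborel A) (emeasure lborel A') \<le> emeasure lborel B"
  \<comment> \<open>For \<open>l = 0\<close> the second summand collapses to the point
    \<open>s\<close>, and \<open>B\<close> contains a translate of \<open>A\<close>; for empty
    \<open>A'\<close> the minimum is zero.\<close>
  proof (cases "l = 0 \<or> A' = {}")
    case True
    show ?thesis
    proof (cases "A' = {}")
      case False
      then have "(\<lambda>x. s + x) ` A \<subseteq> B" using AB True by (auto simp: add.commute)
      then have "emeasure lborel A \<le> emeasure lborel B"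
        using emeasure_mono[of "(\<lambda>x. s + x) ` A" B lborel] emeasure_lborel_translate(2)[OF S(1)] S by simp
      then show ?thesis using False True by (auto intro: min.coboundedI1)
    qed simp
  next
    case False
    then have l: "l \<noteq> 0" by simp
    \<comment> \<open>Writing the dilate of \<open>A'\<close> as a preimage makes its measurability
      immediate.\<close>
    define D where "D = (\<lambda>z. s + z) ` ((\<lambda>z. inverse l * z) -` A')"
    have D0: "(\<lambda>z. inverse l * z) -` A' \<in> sets borel"
      using measurable_sets[of "\<lambda>z. inverse l * z" borel borel A'] by simp
    then have D: "D \<in> sets borel"
      unfolding D_def by (rule sets_borel_translate)
    have "emeasure lborel D = emeasure lborel ((\<lambda>z. inverse l * z) -` A')"
      unfolding D_def by (rule emeasure_lborel_translate(2)[OF D0])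
    also have "\<dots> = ennreal ((cmod l)\<^sup>2) * emeasure lborel A'"
      using l S by (intro emeasure_lborel_times_complex) auto
    finally have eD: "emeasure lborel D = ennreal ((cmod l)\<^sup>2) * emeasure lborel A'" .
    have AD: "x + y \<in> B" if "x \<in> A" "y \<in> D" for x y
    proof -
      obtain z where "inverse l * z \<in> A'" "y = s + z" using \<open>y \<in> D\<close> by (auto simp: D_def)
      moreover from this have "x + (s + l * (inverse l * z)) \<in> B" using AB \<open>x \<in> A\<close> by blast
      ultimately show ?thesis using l by (simp add: mult.assoc[symmetric])
    qed
    let ?m = "min (emeasure lborel A) (emeasure lborel A')" and ?c = "ennreal ((1 + cmod l)\<^sup>2)"
    have c: "?c \<noteq> 0" "?c \<noteq> \<infinity>"
      using add_pos_nonneg[of 1 "cmod l"] by auto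
    have fin: "?c * ennreal a \<le> emeasure lborel B" if a: "0 < a" "ennreal a < ?m" for a
    proof -
      have "ennreal ((cmod l)\<^sup>2 * a) < emeasure lborel D"
        unfolding eD using a l by (simp add: ennreal_mult ennreal_mult_strict_left_mono)
      then have "ennreal ((sqrt a + sqrt ((cmod l)\<^sup>2 * a))\<^sup>2) \<le> emeasure lborel B"
        using a l by (intro brunn_minkowski_complex[OF S(1) D S(3) AD]) auto
      also have "(sqrt a + sqrt ((cmod l)\<^sup>2 * a))\<^sup>2 = (1 + cmod l)\<^sup>2 * a"
      proof -
        have "sqrt a + sqrt ((cmod l)\<^sup>2 * a) = (1 + cmod l) * sqrt a"
          by (simp add: real_sqrt_mult distrib_right)
        then show ?thesis using a by (simp add: power_mult_distrib)
      qed
      finally show ?thesis using a by (simp add: ennreal_mult)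
    qed
    \<comment> \<open>Testing only values below the minimum keeps the levels finite, even if both
      areas are infinite.\<close>
    have "?m \<le> emeasure lborel B / ?c"
    proof (rule dense_le)
      fix x assume x: "x < ?m"
      then obtain a where a: "x = ennreal a" "0 \<le> a" by (cases x) auto
      show "x \<le> emeasure lborel B / ?c"
      proof (cases "a = 0")
        case False
        then show ?thesis
          using divide_right_mono_ennreal[OF fin[of a], of ?c] x a c
          by (simp add: mult.commute[of ?c] mult_divide_eq_ennreal)
      qed (simp add: a)
    qed
    then have "?c * ?m \<le> ?c * (emeasure lborel B / ?c)" by (rule mult_left_mono) simp
    also have "\<dots> = emeasure lborel B"
      using c by (simp add: ennreal_times_divide mult_divide_eq_ennreal mult.commute[of ?c])
    finally show ?thesis .
  qed
qed

section \<open>Triangular complex operators\<close>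

text \<open>This splits off one coordinate as the second factor of a binary product, the form that
  \<open>expands_pair\<close> handles.\<close>

lemma (in product_sigma_finite) distr_PiM_insert:
  assumes I: "finite I" "i \<notin> I"
  shows "distr (PiM I M \<Otimes>\<^sub>M M i) (PiM (insert i I) M) (\<lambda>(f, y). f(i := y)) = PiM (insert i I) M"
proof (rule PiM_eqI)
  interpret finite_product_sigma_finite M I by standard fact
  interpret pair_sigma_finite "PiM I M" "M i" by standard
  fix A assume A: "\<And>j. j \<in> insert i I \<Longrightarrow> A j \<in> sets (M j)"
  have [measurable]: "Pi\<^sub>E (insert i I) A \<in> sets (PiM (insert i I) M)"
    using I A by (intro sets_PiM_I_finite) auto
  have "f(i := y) \<in> Pi\<^sub>E (insert i I) A \<longleftrightarrow> f \<in> Pi\<^sub>E I A \<and> y \<in> A i"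
    if "f \<in> extensional I" for f y
    using I that by (auto simp: PiE_iff extensional_def)
  then have "(\<lambda>(f, y). f(i := y)) -` (Pi\<^sub>E (insert i I) A) \<inter> space (PiM I M \<Otimes>\<^sub>M M i) = Pi\<^sub>E I A \<times> A i"
    using A[THEN sets.sets_into_space, OF insertI1] A[THEN sets.sets_into_space, OF insertI2]
    unfolding space_pair_measure space_PiM by (auto simp: PiE_iff) blast
  then show "emeasure (distr (PiM I M \<Otimes>\<^sub>M M i) (PiM (insert i I) M) (\<lambda>(f, y). f(i := y))) (Pi\<^sub>E (insert i I) A)
      = (\<Prod>j\<in>insert i I. emeasure (M j) (A j))"
    using I A by (subst emeasure_distr)
      (auto simp: M.emeasure_pair_measure_Times emeasure_PiM mult.commute intro!: measurable_add_dim sets_PiM_I_finite)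
qed (use I in auto)

text \<open>Coordinates are added in order of increasing rank \<open>f\<close>. An abstract rank
  expresses triangularity without an order on the index type.\<close>

lemma expands_PiM_triangular:
  fixes U :: "'i \<Rightarrow> 'i \<Rightarrow> complex" and f :: "'i \<Rightarrow> 'b::linorder"
  assumes "finite I" and inj: "inj f" and tri: "\<And>i j. f i < f j \<Longrightarrow> U i j = 0"
  shows "expands (PiM I (\<lambda>_. lborel)) (\<lambda>x y. \<lambda>i\<in>I. x i + (\<Sum>j\<in>I. U i j * y j))
    (\<Prod>i\<in>I. (1 + cmod (U i i))\<^sup>2)"
  using \<open>finite I\<close>
proof (induction rule: finite_ranking_induct[where f=f])
  case empty
  show ?case
    unfolding expands_def
  proof (intro ballI impI)
    fix A B assume A: "A \<in> sets (PiM {} (\<lambda>_. lborel :: complex measure))"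
      and B: "B \<in> sets (PiM {} (\<lambda>_. lborel :: complex measure))"
      and AB: "\<forall>x\<in>A. \<forall>y\<in>A. (\<lambda>i\<in>{}. x i + (\<Sum>j\<in>{}. U i j * y j)) \<in> B"
    \<comment> \<open>The space is a single point, which the operation returns; the constant is the
      empty product 1.\<close>
    have "A \<subseteq> B"
    proof
      fix x assume "x \<in> A"
      then have "x = (\<lambda>i\<in>{}. undefined)" using sets.sets_into_space[OF A] by (auto simp: space_PiM)
      then show "x \<in> B" using AB \<open>x \<in> A\<close> by (fastforce simp: restrict_def)
    qed
    then show "ennreal (\<Prod>i\<in>{}. (1 + cmod (U i i))\<^sup>2) * emeasure (PiM {} (\<lambda>_. lborel)) A
      \<le> emeasure (PiM {} (\<lambda>_. lborel)) B"
      using B by (simp add: emeasure_mono)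
  qed
next
  case (insert k I)
  \<comment> \<open>The new index has the largest rank, so the old components do not depend on it.\<close>
  show ?case
  proof (cases "k \<in> I")
    case False
    interpret product_sigma_finite "\<lambda>_::'i. lborel :: complex measure" by standard
    have U0: "U i k = 0" if "i \<in> I" for i
      using insert.hyps(2)[OF that] that False inj by (intro tri) (auto simp: order.strict_iff_order inj_eq)
    \<comment> \<open>The old coordinates form the base. In the fibre, \<open>w'\<close> enters only
      through a shift and \<open>v'\<close> through the diagonal entry, which is the situation of
      \<open>expands2_complex\<close>.\<close>
    have "expands (PiM I (\<lambda>_. lborel) \<Otimes>\<^sub>M lborel)
      (\<lambda>(w, v) (w', v'). (\<lambda>i\<in>I. w i + (\<Sum>j\<in>I. U i j * w' j), v + ((\<Sum>j\<in>I. U k j * w' j) + U k k * v')))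
      ((\<Prod>i\<in>I. (1 + cmod (U i i))\<^sup>2) * (1 + cmod (U k k))\<^sup>2)"
      using add_pos_nonneg[of 1 "cmod (U k k)"]
      by (intro expands_pair sigma_finite insert expands2_complex lborel.sigma_finite_measure_axioms)
        (auto intro: prod_nonneg)
    then have "expands (PiM (insert k I) (\<lambda>_. lborel))
       (\<lambda>x y. \<lambda>i\<in>insert k I. x i + (\<Sum>j\<in>insert k I. U i j * y j))
      ((\<Prod>i\<in>I. (1 + cmod (U i i))\<^sup>2) * (1 + cmod (U k k))\<^sup>2)"
    proof (rule expands_distr)
      show "distr (PiM I (\<lambda>_. lborel) \<Otimes>\<^sub>M lborel) (PiM (insert k I) (\<lambda>_. lborel)) (\<lambda>(f, y). f(k := y))
        = PiM (insert k I) (\<lambda>_. lborel :: complex measure)"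
        by (rule distr_PiM_insert[OF insert.hyps(1) False])
      fix p q assume "p \<in> space (PiM I (\<lambda>_. lborel :: complex measure) \<Otimes>\<^sub>M (lborel :: complex measure))"
        "q \<in> space (PiM I (\<lambda>_. lborel :: complex measure) \<Otimes>\<^sub>M (lborel :: complex measure))"
      obtain w v w' v' where pq: "p = (w, v)" "q = (w', v')" by (metis surj_pair)
      have "(\<Sum>j\<in>I. U i j * (if j = k then v' else w' j)) = (\<Sum>j\<in>I. U i j * w' j)" for i
        using False by (intro sum.cong) auto
      then show "(\<lambda>(w, v) (w', v'). (\<lambda>i\<in>I. w i + (\<Sum>j\<in>I. U i j * w' j), v + ((\<Sum>j\<in>I. U k j * w' j) + U k k * v'))) p q
          \<in> space (PiM I (\<lambda>_. lborel) \<Otimes>\<^sub>M lborel) \<and>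
        (\<lambda>(f, y). f(k := y)) ((\<lambda>(w, v) (w', v'). (\<lambda>i\<in>I. w i + (\<Sum>j\<in>I. U i j * w' j), v + ((\<Sum>j\<in>I. U k j * w' j) + U k k * v'))) p q)
        = (\<lambda>i\<in>insert k I. (\<lambda>(f, y). f(k := y)) p i + (\<Sum>j\<in>insert k I. U i j * (\<lambda>(f, y). f(k := y)) q j))"
        using False insert.hyps(1)
        by (auto simp: pq space_pair_measure space_PiM fun_eq_iff U0 restrict_def algebra_simps)
    qed (rule measurable_add_dim)
    then show ?thesis
      unfolding prod.insert[OF insert.hyps(1) False] mult.commute[of "(1 + cmod (U k k))\<^sup>2"] .
  \<comment> \<open>The ranking induction also admits a \<open>k\<close> already in
    \<open>I\<close>; then the set stays the same.\<close>
  qed (use insert in \<open>simp add: insert_absorb\<close>)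
qed

text \<open>\<open>\<complex>\<^sup>n\<close> is encoded as \<open>\<real>\<^sup>n \<times> \<real>\<^sup>n\<close>, on which Lebesgue measure is a product and \<open>A \<times> A\<close> is
  available for real sets \<open>A\<close>.\<close>

definition of_complex_vec :: "complex ^ 'n \<Rightarrow> (real ^ 'n) \<times> (real ^ 'n)" where
  "of_complex_vec z = (\<chi> i. Re (z $ i), \<chi> i. Im (z $ i))"

definition to_complex_vec :: "(real ^ 'n) \<times> (real ^ 'n) \<Rightarrow> complex ^ 'n" where
  "to_complex_vec p = (\<chi> i. Complex (fst p $ i) (snd p $ i))"

definition cmul :: "complex ^ 'n ^ 'n \<Rightarrow> (real ^ 'n) \<times> (real ^ 'n) \<Rightarrow> (real ^ 'n) \<times> (real ^ 'n)" where
  "cmul A p = of_complex_vec (A *v to_complex_vec p)"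

lemma to_of_complex_vec [simp]: "to_complex_vec (of_complex_vec z) = z"
  and of_to_complex_vec [simp]: "of_complex_vec (to_complex_vec p) = p"
  by (simp_all add: to_complex_vec_def of_complex_vec_def prod_eq_iff)

lemma to_complex_vec_add: "to_complex_vec (p + q) = to_complex_vec p + to_complex_vec q"
  by (simp add: to_complex_vec_def vec_eq_iff complex_eq_iff)

lemma of_complex_vec_add: "of_complex_vec (p + q) = of_complex_vec p + of_complex_vec q"
  by (simp add: of_complex_vec_def vec_eq_iff)

lemma cmul_add: "cmul A (p + q) = cmul A p + cmul A q"
  by (simp add: cmul_def to_complex_vec_add of_complex_vec_add matrix_vector_right_distrib)

lemma cmul_cmul: "cmul A (cmul B p) = cmul (A ** B) p"
  by (simp add: cmul_def matrix_vector_mul_assoc)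

lemma cmul_1 [simp]: "cmul (Finite_Cartesian_Product.mat 1) p = p"
  by (simp add: cmul_def)

lemma linear_cmul: "linear (cmul (A :: complex ^ 'n ^ 'n))"
proof (rule linearI)
  fix r :: real and p :: "(real ^ 'n) \<times> (real ^ 'n)"
  have "to_complex_vec (r *\<^sub>R p) = of_real r *s to_complex_vec p"
    by (simp add: to_complex_vec_def vec_eq_iff complex_eq_iff)
  moreover have "of_complex_vec (of_real r *s z) = r *\<^sub>R of_complex_vec z" for z :: "complex ^ 'n"
    by (simp add: of_complex_vec_def vec_eq_iff)
  ultimately show "cmul A (r *\<^sub>R p) = r *\<^sub>R cmul A p"
    by (simp add: cmul_def vector_scalar_commute)
qed (rule cmul_add)

text \<open>A real matrix acts on real and imaginary parts separately. Hence an inclusion for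
  \<open>A\<close> and \<open>B\<close> becomes one for \<open>A \<times> A\<close> and
  \<open>B \<times> B\<close>.\<close>

lemma cmul_complex_matrix:
  assumes "linear T"
  shows "cmul (complex_matrix T) (x, y) = (T x, T y)"
proof -
  have *: "T x $ i = (\<Sum>j\<in>UNIV. matrix T $ i $ j * x $ j)" for x i
    using matrix_vector_mul(2)[OF assms] by (simp add: matrix_vector_mult_def fun_eq_iff vec_eq_iff)
  show ?thesis
    by (simp add: * cmul_def of_complex_vec_def to_complex_vec_def complex_matrix_def vec_eq_iff
      matrix_vector_mult_def map_matrix_def)
qed

lemma measurable_of_complex_vec_PiM:
  "(\<lambda>z. of_complex_vec (\<chi> i. z i)) \<in> measurable (PiM UNIV (\<lambda>_::'n::finite. lborel)) borel"
proof -
  have "(\<lambda>z. of_complex_vec (\<chi> i. z i)) \<in> measurable (PiM UNIV (\<lambda>_::'n. borel)) borel"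
    unfolding of_complex_vec_def borel_prod[symmetric]
    by (rule measurable_Pair; rule borel_measurable_euclidean_space[THEN iffD2])
      (auto simp: Basis_vec_def inner_axis)
  then show ?thesis by (simp cong: measurable_cong_sets sets_PiM_cong)
qed

text \<open>A box of pairs corresponds to a product of rectangles in the complex plane, one per
  coordinate, whose areas regroup into the volumes of the real and the imaginary box.\<close>

lemma lborel_complex_PiM:
  "distr (PiM UNIV (\<lambda>_::'n. lborel)) borel (\<lambda>z. of_complex_vec (\<chi> i. z i)) =
    (lborel :: ((real ^ 'n) \<times> (real ^ 'n)) measure)"
proof (rule lborel_eqI[symmetric])
  interpret product_sigma_finite "\<lambda>_::'n. lborel :: complex measure" by standard
  let ?P = "PiM UNIV (\<lambda>_::'n. lborel :: complex measure)"
  let ?h = "\<lambda>z :: 'n \<Rightarrow> complex. of_complex_vec (\<chi> i. z i)"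
  note h = measurable_of_complex_vec_PiM
  fix l u :: "(real ^ 'n) \<times> (real ^ 'n)" assume le: "\<And>b. b \<in> Basis \<Longrightarrow> l \<bullet> b \<le> u \<bullet> b"
  obtain la lb ua ub where lu: "l = (la, lb)" "u = (ua, ub)" by (metis surj_pair)
  have "(axis i 1, 0) \<in> (Basis :: ((real ^ 'n) \<times> (real ^ 'n)) set)"
    "(0, axis i 1) \<in> (Basis :: ((real ^ 'n) \<times> (real ^ 'n)) set)" for i :: 'n
    unfolding Basis_prod_def by (simp_all add: axis_in_Basis_iff)
  then have "la $ i \<le> ua $ i" "lb $ i \<le> ub $ i" for i
    using le[of "(axis i 1, 0)"] le[of "(0, axis i 1)"] by (auto simp: lu inner_axis)
  note le' = this
  have box: "box l u = box la ua \<times> box lb ub"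
    by (auto simp: lu mem_box Basis_prod_def ball_Un)
  have "?h -` box l u = Pi\<^sub>E UNIV (\<lambda>i. box (Complex (la $ i) (lb $ i)) (Complex (ua $ i) (ub $ i)))"
    by (auto simp: box of_complex_vec_def mem_box_cart mem_box_complex PiE_iff)
  then have "emeasure (distr ?P borel ?h) (box l u)
      = emeasure ?P (Pi\<^sub>E UNIV (\<lambda>i. box (Complex (la $ i) (lb $ i)) (Complex (ua $ i) (ub $ i))))"
    by (simp add: emeasure_distr[OF h] space_PiM)
  also have "\<dots> = (\<Prod>i\<in>UNIV. emeasure lborel (box (Complex (la $ i) (lb $ i)) (Complex (ua $ i) (ub $ i))))"
    by (rule emeasure_PiM) auto
  also have "\<dots> = (\<Prod>i\<in>UNIV. ennreal ((ua $ i - la $ i) * (ub $ i - lb $ i)))"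
    using le' by (simp add: emeasure_lborel_box_complex)
  also have "\<dots> = ennreal (\<Prod>i\<in>UNIV. ua $ i - la $ i) * ennreal (\<Prod>i\<in>UNIV. ub $ i - lb $ i)"
    using le' by (simp add: prod_ennreal prod.distrib ennreal_mult prod_nonneg)
  also have "\<dots> = emeasure (lborel \<Otimes>\<^sub>M lborel) (box l u)"
    unfolding box using le' by (simp add: lborel.emeasure_pair_measure_Times emeasure_lborel_box_cart)
  also have "\<dots> = ennreal (\<Prod>b\<in>Basis. (u - l) \<bullet> b)"
    unfolding lborel_prod using le by (rule emeasure_lborel_box)
  finally show "emeasure (distr ?P borel ?h) (box l u) = ennreal (\<Prod>b\<in>Basis. (u - l) \<bullet> b)" .
qed simp

lemma expands_cmul_triangular:
  fixes U :: "complex ^ 'n ^ 'n" and f :: "'n \<Rightarrow> 'b::linorder"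
  assumes "inj f" and "\<And>i j. f i < f j \<Longrightarrow> U $ i $ j = 0"
  shows "expands lborel (\<lambda>p q. p + cmul U q) (\<Prod>i\<in>UNIV. (1 + cmod (U $ i $ i))\<^sup>2)"
proof -
  have *: "of_complex_vec (\<chi> i. x i + (\<Sum>j\<in>UNIV. U $ i $ j * y j))
    = of_complex_vec (\<chi> i. x i) + cmul U (of_complex_vec (\<chi> i. y i))" for x y
    by (simp add: cmul_def of_complex_vec_add[symmetric]) (simp add: matrix_vector_mult_def plus_vec_def)
  show ?thesis
  proof (rule expands_distr[OF expands_PiM_triangular[where U = "\<lambda>i j. U $ i $ j", OF finite assms], where f = "\<lambda>z. of_complex_vec (\<chi> i. z i)"])
    show "distr (PiM UNIV (\<lambda>_::'n. lborel)) lborel (\<lambda>z. of_complex_vec (\<chi> i. z i)) = lborel"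
      using lborel_complex_PiM by (simp cong: distr_cong)
  qed (use measurable_of_complex_vec_PiM in \<open>auto simp: space_PiM *\<close>)
qed

text \<open>The change of variables is \<open>cmul P\<close>, which intertwines \<open>U\<close>
  with its conjugate because \<open>Q ** P\<close> is the identity.\<close>

lemma expands_cmul_similar:
  fixes P Q U :: "complex ^ 'n ^ 'n"
  assumes "expands lborel (\<lambda>p q. p + cmul U q) c" "P ** Q = Finite_Cartesian_Product.mat 1" "Q ** P = Finite_Cartesian_Product.mat 1"
  shows "expands lborel (\<lambda>p q. p + cmul (P ** U ** Q) q) c"
proof (rule expands_lborel_linear[OF linear_cmul _ assms(1)])
  show "inj (cmul P)"
    by (rule inj_on_inverseI[of _ "cmul Q"]) (simp add: cmul_cmul assms)
  show "cmul P (p + cmul U q) = cmul P p + cmul (P ** U ** Q) (cmul P q)" for p q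
    by (simp add: cmul_add cmul_cmul assms matrix_mul_assoc[symmetric])
qed

section \<open>Schur triangularization and eigenvalues\<close>

text \<open>A permutation with a nonzero term never raises the rank. Since permuting preserves the
  sum of all ranks, it never lowers it either, and injectivity of \<open>f\<close> leaves only the
  identity.\<close>

lemma det_triangular_rank:
  fixes A :: "'a::comm_ring_1 ^ 'n ^ 'n" and f :: "'n \<Rightarrow> int"
  assumes inj: "inj f" and tri: "\<And>i j. f i < f j \<Longrightarrow> A $ i $ j = 0"
  shows "Determinants.det A = (\<Prod>i\<in>UNIV. A $ i $ i)"
proof -
  have zero: "(\<Prod>i\<in>UNIV. A $ i $ p i) = 0" if p: "p permutes UNIV" "p \<noteq> id" for p
  proof (rule ccontr)
    assume nz: "(\<Prod>i\<in>UNIV. A $ i $ p i) \<noteq> 0"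
    have le: "f (p i) \<le> f i" for i
    proof (rule ccontr)
      assume "\<not> f (p i) \<le> f i"
      then have "A $ i $ p i = 0" by (intro tri) simp
      then show False using nz by (metis UNIV_I finite prod_zero)
    qed
    obtain i where "p i \<noteq> i" using p(2) by (auto simp: fun_eq_iff)
    then have "f (p i) < f i" using le[of i] inj by (auto simp: order.strict_iff_order inj_eq)
    then have "(\<Sum>i\<in>UNIV. f (p i)) < (\<Sum>i\<in>UNIV. f i)"
      by (intro sum_strict_mono_ex1) (auto simp: le)
    then show False using sum.permute[OF p(1), of f] by (simp add: comp_def)
  qed
  have "Determinants.det A = (\<Sum>p\<in>{id}. of_int (sign p) * (\<Prod>i\<in>UNIV. A $ i $ p i))"
    unfolding Determinants.det_def
    by (rule sum.mono_neutral_right) (auto simp: permutes_id zero)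
  then show ?thesis by (simp add: sign_id)
qed

text \<open>Schur decomposition is carried from matrices indexed by \<open>0, ..., n - 1\<close> to
  the index type along a bijection \<open>g\<close>. Upper triangular means zero entries for
  \<open>g j < g i\<close>, so the rank is minus \<open>g\<close>.\<close>

lemma complex_schur:
  fixes A :: "complex ^ 'n ^ 'n"
  obtains P Q U :: "complex ^ 'n ^ 'n" and f :: "'n \<Rightarrow> int"
  where "P ** Q = Finite_Cartesian_Product.mat 1" "Q ** P = Finite_Cartesian_Product.mat 1"
    "A = P ** U ** Q" "inj f" "\<And>i j. f i < f j \<Longrightarrow> U $ i $ j = 0"
proof -
  let ?n = "CARD('n)"
  obtain g :: "'n \<Rightarrow> nat" where g: "bij_betw g UNIV {0..<?n}"
    using ex_bij_betw_finite_nat[of "UNIV :: 'n set"] by auto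
  then have inj: "inj g" and lt: "g i < ?n" for i by (auto simp: bij_betw_def)
  define h where "h = inv_into UNIV g"
  have h: "h (g i) = i" for i unfolding h_def using inj by simp
  define F :: "complex mat \<Rightarrow> complex ^ 'n ^ 'n" where "F M = (\<chi> i j. M $$ (g i, g j))" for M
  have F_mult: "F (M * N) = F M ** F N" if "M \<in> carrier_mat ?n ?n" "N \<in> carrier_mat ?n ?n" for M N
  proof -
    have "(M * N) $$ (g i, g j) = (\<Sum>k\<in>UNIV. M $$ (g i, g k) * N $$ (g k, g j))" for i j
    proof -
      have "(M * N) $$ (g i, g j) = (\<Sum>k\<in>{0..<?n}. M $$ (g i, k) * N $$ (k, g j))"
        using that lt[of i] lt[of j] by (auto simp: scalar_prod_def)
      also have "\<dots> = (\<Sum>k\<in>UNIV. M $$ (g i, g k) * N $$ (g k, g j))"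
        by (rule sum.reindex_bij_betw[OF g, symmetric])
      finally show ?thesis .
    qed
    then show ?thesis by (simp add: F_def matrix_matrix_mult_def vec_eq_iff)
  qed
  have F_1: "F (1\<^sub>m ?n) = Finite_Cartesian_Product.mat 1"
    using inj lt by (auto simp: F_def Finite_Cartesian_Product.mat_def vec_eq_iff inj_eq)
  define A' where "A' = Matrix.mat ?n ?n (\<lambda>(a, b). A $ h a $ h b)"
  have A': "A' \<in> carrier_mat ?n ?n" by (simp add: A'_def)
  have FA: "F A' = A" by (simp add: F_def A'_def lt h vec_eq_iff)
  \<comment> \<open>Over the complex numbers the characteristic polynomial splits, which supplies
    the eigenvalue list for the decomposition.\<close>
  obtain es where es: "char_poly A' = (\<Prod>a\<leftarrow>es. [:- a, 1:])"
    using char_poly_factorized[OF A'] by auto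
  obtain B P Q where BPQ: "schur_decomposition A' es = (B, P, Q)" by (metis prod_cases3)
  from schur_decomposition[OF A' es BPQ]
  have wit: "similar_mat_wit A' B P Q" and tri: "upper_triangular B" by auto
  from wit A' have *: "P \<in> carrier_mat ?n ?n" "Q \<in> carrier_mat ?n ?n" "B \<in> carrier_mat ?n ?n"
    "P * Q = 1\<^sub>m ?n" "Q * P = 1\<^sub>m ?n" "A' = P * B * Q"
    by (auto simp: similar_mat_wit_def Let_def)
  show thesis
  proof (rule that[of "F P" "F Q" "F B" "\<lambda>i. - int (g i)"])
    show "F P ** F Q = Finite_Cartesian_Product.mat 1" "F Q ** F P = Finite_Cartesian_Product.mat 1"
      using * F_1 by (simp_all flip: F_mult)
    show "A = F P ** F B ** F Q"
      using * FA mult_carrier_mat[of P ?n ?n B ?n] by (simp flip: F_mult)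
    show "inj (\<lambda>i. - int (g i))" using inj by (auto simp: inj_def)
    show "F B $ i $ j = 0" if "- int (g i) < - int (g j)" for i j
      using that tri * lt[of i] by (auto simp: F_def upper_triangular_def)
  qed
qed

text \<open>Similarity preserves the characteristic polynomial, so its roots with multiplicity are
  the diagonal entries of \<open>U\<close>. The identity of polynomials is checked at each point
  \<open>x\<close>, where it concerns complex determinants.\<close>

lemma H_similar_triangular:
  fixes P Q U :: "complex ^ 'n ^ 'n" and f :: "'n \<Rightarrow> int"
  assumes "P ** Q = Finite_Cartesian_Product.mat 1" "complex_matrix T = P ** U ** Q"
    and f: "inj f" "\<And>i j. f i < f j \<Longrightarrow> U $ i $ j = 0"
  shows "H T = (\<Prod>i\<in>UNIV. 1 + cmod (U $ i $ i))"
proof -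
  have "poly (charpoly T) x = poly (\<Prod>i\<in>UNIV. [:- (U $ i $ i), 1:]) x" for x
  proof -
    let ?X = "Finite_Cartesian_Product.mat x :: complex ^ 'n ^ 'n"
    have "?X - complex_matrix T = P ** (?X - U) ** Q"
    proof -
      \<comment> \<open>Scalar matrices are fixed by conjugation, so \<open>P\<close> and
        \<open>Q\<close> conjugate the characteristic matrix as well.\<close>
      have "?X ** Q = Q ** ?X"
        by (simp add: matrix_matrix_mult_def Finite_Cartesian_Product.mat_def vec_eq_iff
          if_distrib if_distribR mult.commute cong: if_cong)
      then have "P ** ?X ** Q = ?X"
        using assms(1) by (metis matrix_mul_assoc matrix_mul_lid)
      moreover have "P ** (?X - U) ** Q = P ** ?X ** Q - P ** U ** Q"
        by (simp add: matrix_matrix_mult_def vec_eq_iff sum_subtractf algebra_simps)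
      ultimately show ?thesis using assms(2) by simp
    qed
    then have "poly (charpoly T) x = Determinants.det P * Determinants.det (?X - U) * Determinants.det Q"
      by (simp add: poly_charpoly Determinants.det_mul)
    also have "\<dots> = Determinants.det (P ** Q) * Determinants.det (?X - U)"
      by (simp add: Determinants.det_mul)
    also have "\<dots> = (\<Prod>i\<in>UNIV. (?X - U) $ i $ i)"
    proof -
      have "Determinants.det (?X - U) = (\<Prod>i\<in>UNIV. (?X - U) $ i $ i)"
        by (rule det_triangular_rank[OF f(1)]) (auto simp: Finite_Cartesian_Product.mat_def f(2))
      then show ?thesis by (simp add: assms(1) Determinants.det_I)
    qed
    finally show ?thesis
      by (simp add: poly_prod Finite_Cartesian_Product.mat_def)
  qed
  then have "charpoly T = (\<Prod>i\<in>UNIV. [:- (U $ i $ i), 1:])"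
    by (simp add: poly_eq_poly_eq_iff[symmetric] fun_eq_iff)
  then have "proots (charpoly T) = (\<Sum>i\<in>UNIV. {#U $ i $ i#})"
    by (simp add: proots_prod)
  moreover have "(\<Prod>l\<in>#(\<Sum>i\<in>A. {#U $ i $ i#}). 1 + cmod l) = (\<Prod>i\<in>A. 1 + cmod (U $ i $ i))"
    if "finite A" for A
    using that by induction auto
  ultimately show ?thesis by (simp add: H_eq_prod_proots)
qed

section \<open>The sumset inequality\<close>

text \<open>The complexified operator expands by \<open>(H T)^2\<close>; on
  \<open>A \<times> A\<close> and \<open>B \<times> B\<close> both sides are squares, and the root
  is taken at the end.\<close>

lemma emeasure_sumset_ge:
  fixes T :: "real ^ 'n \<Rightarrow> real ^ 'n"
  assumes T: "linear T" and A: "A \<in> sets borel" and B: "B \<in> sets borel"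
    and AB: "\<And>x y. x \<in> A \<Longrightarrow> y \<in> A \<Longrightarrow> x + T y \<in> B"
  shows "ennreal (H T) * emeasure lborel A \<le> emeasure lborel B"
proof -
  obtain P Q U :: "complex ^ 'n ^ 'n" and f :: "'n \<Rightarrow> int"
    where PQ: "P ** Q = Finite_Cartesian_Product.mat 1" "Q ** P = Finite_Cartesian_Product.mat 1"
      and U: "complex_matrix T = P ** U ** Q" and f: "inj f" "\<And>i j. f i < f j \<Longrightarrow> U $ i $ j = 0"
    using complex_schur[of "complex_matrix T"] by blast
  have H: "H T = (\<Prod>i\<in>UNIV. 1 + cmod (U $ i $ i))"
    by (rule H_similar_triangular[OF PQ(1) U f])
  have "expands lborel (\<lambda>p q. p + cmul U q) ((H T)\<^sup>2)"
    unfolding H prod_power_distrib by (rule expands_cmul_triangular[OF f])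
  from expands_cmul_similar[OF this PQ]
  have ex: "expands (lborel \<Otimes>\<^sub>M lborel) (\<lambda>p q. p + cmul (complex_matrix T) q) ((H T)\<^sup>2)"
    by (simp add: U lborel_prod)
  have "ennreal ((H T)\<^sup>2) * emeasure (lborel \<Otimes>\<^sub>M lborel) (A \<times> A) \<le> emeasure (lborel \<Otimes>\<^sub>M lborel) (B \<times> B)"
    by (rule expandsD[OF ex]) (use A B AB in \<open>auto simp: cmul_complex_matrix[OF T]\<close>)
  moreover have "0 \<le> H T" unfolding H by (intro prod_nonneg) simp
  ultimately have "(ennreal (H T) * emeasure lborel A)\<^sup>2 \<le> (emeasure lborel B)\<^sup>2"
    using A B by (simp add: lborel.emeasure_pair_measure_Times power2_eq_square ennreal_mult mult_ac)
  \<comment> \<open>Squaring reflects the order in \<open>ennreal\<close>; infinite values are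
    separate cases.\<close>
  then show ?thesis
    by (cases "ennreal (H T) * emeasure lborel A"; cases "emeasure lborel B")
      (auto simp: ennreal_power top_power_ennreal top_unique)
qed

theorem theorem2:
  fixes T :: "real ^ 'n \<Rightarrow> real ^ 'n" and K :: "(real ^ 'n) set"
  assumes "linear T"
  shows "inner_lebesgue {x + T y | x y. x \<in> K \<and> y \<in> K} \<ge> ennreal (H T) * inner_lebesgue K"
proof -
  let ?S = "\<lambda>X. {x + T y | x y. x \<in> X \<and> y \<in> X}"
  \<comment> \<open>The sumset of a compact \<open>C\<close> is the image of a compact set, hence
    Borel and itself a competitor in the supremum for \<open>?S K\<close>.\<close>
  have "ennreal (H T) * emeasure lebesgue C \<le> inner_lebesgue (?S K)" if C: "compact C" "C \<subseteq> K" for C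
  proof -
    have "compact (T ` C)"
      using assms C(1) by (intro compact_continuous_image linear_continuous_on) (simp add: linear_linear)
    moreover have "?S C = {x + z | x z. x \<in> C \<and> z \<in> T ` C}" by auto
    ultimately have S: "compact (?S C)" using compact_sums[OF C(1)] by simp
    have "ennreal (H T) * emeasure lborel C \<le> emeasure lborel (?S C)"
      by (rule emeasure_sumset_ge[OF assms]) (use C S in \<open>auto intro: borel_compact\<close>)
    then have "ennreal (H T) * emeasure lebesgue C \<le> emeasure lebesgue (?S C)"
      using C S by (simp add: borel_compact)
    also have "\<dots> \<le> inner_lebesgue (?S K)"
      unfolding inner_lebesgue_def using S C by (intro SUP_upper) auto
    finally show ?thesis .
  qed
  then show ?thesis
    unfolding inner_lebesgue_def[of K] by (subst SUP_mult_left_ennreal) (auto intro: SUP_least)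
qed

end
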